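(* Let $D$ be a $3$-anti-traceable oriented graph with $|V(D)|\geq 5$. If $|V(D)|$ is even, then $D$ has a hamiltonian anti-directed cycle. If $|V(D)|$ is odd, then $D$ has an anti-directed cycle of length $|V(D)|-1$ and a hamiltonian anti-directed path.
   Context: An oriented graph is a digraph obtained by orienting the edges of a simple undirected graph. An oriented path $x_1\dots x_p$ is anti-directed if every two consecutive arcs have opposite orientations; an anti-directed cycle is an oriented cycle in which every two cyclically consecutive arcs have opposite orientations. Hamiltonian means containing all vertices; the length of a cycle is its number of vertices. A digraph is anti-traceable if it has a hamiltonian anti-directed path, and $k$-anti-traceable if it has at least $k$ vertices and every induced subdigraph on $k$ vertices is anti-traceable. *)

theory Defs
  imports "Graph_Theory.Digraph_Component"
begin

locale oriented_graph = digraph +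
  assumes asym_arcs: "asym (arcs_ends G)"

lemma (in fin_digraph) oriented_graph_iff_orientation:
  "oriented_graph G \<longleftrightarrow>
    (\<exists>E. (\<forall>X\<in>E. X \<subseteq> verts G \<and> card X = 2) \<and>
         bij_betw (\<lambda>e. {tail G e, head G e}) (arcs G) E)"
  (is "?L \<longleftrightarrow> ?R")
proof
  assume ?L
  then interpret O: oriented_graph G .
  let ?f = "\<lambda>e. {tail G e, head G e}"
  have "inj_on ?f (arcs G)"
  proof (rule inj_onI)
    fix e1 e2
    assume e: "e1 \<in> arcs G" "e2 \<in> arcs G" "?f e1 = ?f e2"
    have "\<not> (tail G e1 = head G e2 \<and> head G e1 = tail G e2)"
    proof
      assume swap: "tail G e1 = head G e2 \<and> head G e1 = tail G e2"
      have "(tail G e1, head G e1) \<in> arcs_ends G"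
        using e(1) by (auto simp: arcs_ends_conv)
      moreover have "(head G e1, tail G e1) \<in> arcs_ends G"
        using e(2) swap by (auto simp: arcs_ends_conv)
      ultimately show False
        using O.asym_arcs by (meson asymD)
    qed
    with e(3) have "arc_to_ends G e1 = arc_to_ends G e2"
      by (auto simp: doubleton_eq_iff arc_to_ends_def)
    with e show "e1 = e2" by (blast intro: O.no_multi_arcs)
  qed
  moreover have "\<forall>X\<in>?f ` arcs G. X \<subseteq> verts G \<and> card X = 2"
    using O.no_loops by (auto simp: card_insert_if)
  ultimately show ?R by (meson inj_on_imp_bij_betw)
next
  assume ?R
  then obtain E where E: "\<forall>X\<in>E. X \<subseteq> verts G \<and> card X = 2"
    and b: "bij_betw (\<lambda>e. {tail G e, head G e}) (arcs G) E"
    by blast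
  have loop: "tail G e \<noteq> head G e" if "e \<in> arcs G" for e
  proof -
    have "card {tail G e, head G e} = 2"
      using E b that by (auto simp: bij_betw_def)
    then show ?thesis by auto
  qed
  have inj: "e1 = e2"
    if "e1 \<in> arcs G" "e2 \<in> arcs G" "{tail G e1, head G e1} = {tail G e2, head G e2}" for e1 e2
    using b that by (auto simp: bij_betw_def dest: inj_onD)
  show ?L
  proof unfold_locales
    show "asym (arcs_ends G)"
    proof (rule asymI)
      fix u v
      assume "(u, v) \<in> arcs_ends G"
      then obtain e1 where e1: "e1 \<in> arcs G" "tail G e1 = u" "head G e1 = v" by (rule reachableE)
      show "(v, u) \<notin> arcs_ends G"
      proof
        assume "(v, u) \<in> arcs_ends G"
        then obtain e2 where e2: "e2 \<in> arcs G" "tail G e2 = v" "head G e2 = u" by (rule reachableE)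
        have "e1 = e2" using e1 e2 by (intro inj) auto
        with e1 e2 loop[OF e1(1)] show False by simp
      qed
    qed
  qed (use loop inj in \<open>auto simp: arc_to_ends_def\<close>)
qed

definition arc_dir :: "('a, 'b) pre_digraph \<Rightarrow> bool \<Rightarrow> 'a \<Rightarrow> 'a \<Rightarrow> bool" where
  "arc_dir G b u v \<longleftrightarrow> (if b then u \<rightarrow>\<^bsub>G\<^esub> v else v \<rightarrow>\<^bsub>G\<^esub> u)"

text \<open>
  In the next two definitions, \<open>d i\<close> records whether the \<open>i\<close>-th arc of the oriented path
  (or cycle) is traversed forwards or backwards.
\<close>

definition anti_directed_path :: "('a, 'b) pre_digraph \<Rightarrow> 'a list \<Rightarrow> bool" where
  "anti_directed_path G xs \<longleftrightarrow>
     xs \<noteq> [] \<and> distinct xs \<and> set xs \<subseteq> verts G \<and>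
     (\<exists>d :: nat \<Rightarrow> bool.
        (\<forall>i. Suc i < length xs \<longrightarrow> arc_dir G (d i) (xs ! i) (xs ! Suc i)) \<and>
        (\<forall>i. Suc (Suc i) < length xs \<longrightarrow> d i \<noteq> d (Suc i)))"

definition anti_directed_cycle :: "('a, 'b) pre_digraph \<Rightarrow> 'a list \<Rightarrow> bool" where
  "anti_directed_cycle G xs \<longleftrightarrow>
     3 \<le> length xs \<and> distinct xs \<and> set xs \<subseteq> verts G \<and>
     (\<exists>d :: nat \<Rightarrow> bool.
        (\<forall>i < length xs. arc_dir G (d i) (xs ! i) (xs ! (Suc i mod length xs))) \<and>
        (\<forall>i < length xs. d i \<noteq> d (Suc i mod length xs)))"

definition hamiltonian :: "('a, 'b) pre_digraph \<Rightarrow> 'a list \<Rightarrow> bool" where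
  "hamiltonian G xs \<longleftrightarrow> set xs = verts G"

definition anti_traceable :: "('a, 'b) pre_digraph \<Rightarrow> bool" where
  "anti_traceable G \<longleftrightarrow> (\<exists>xs. anti_directed_path G xs \<and> hamiltonian G xs)"

definition k_anti_traceable :: "nat \<Rightarrow> ('a, 'b) pre_digraph \<Rightarrow> bool" where
  "k_anti_traceable k G \<longleftrightarrow>
     k \<le> card (verts G) \<and>
     (\<forall>S \<subseteq> verts G. card S = k \<longrightarrow> anti_traceable (G \<restriction> S))"

end

theory Submission
  imports Defs
begin

text \<open>
  Three vertices induce an anti-traceable digraph iff one of them dominates the other two or is
  dominated by both. Hence dominance is a strict weak order, whose classes of pairwise non-adjacent
  vertices have at most two elements. Listing the vertices along this order, every vertex dominates
  all later ones except possibly its immediate successor, so alternating between an initial and a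
  final segment of the list yields an anti-directed path, which closes up to a cycle when both
  segments have the same length.
\<close>

lemma nth_splice_even:
  assumes "i < length xs" "i \<le> length ys"
  shows "splice xs ys ! (2 * i) = xs ! i"
  using assms
proof (induction i arbitrary: xs ys)
  case 0
  then show ?case by (cases xs) auto
next
  case (Suc i)
  then show ?case by (cases xs; cases ys) auto
qed

lemma nth_splice_odd:
  assumes "i < length xs" "i < length ys"
  shows "splice xs ys ! Suc (2 * i) = ys ! i"
  using assms
proof (induction i arbitrary: xs ys)
  case 0
  then show ?case by (cases xs; cases ys) auto
next
  case (Suc i)
  then show ?case by (cases xs; cases ys) auto
qed

lemma set_splice: "set (splice xs ys) = set xs \<union> set ys"
  using set_shuffles[OF splice_in_shuffles] .

lemma distinct_splice: "distinct (xs @ ys) \<Longrightarrow> distinct (splice xs ys)"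
  using distinct_disjoint_shuffles[OF _ _ _ splice_in_shuffles] by auto

lemma strict_weak_order_imp_ranking:
  fixes R :: "'a \<Rightarrow> 'a \<Rightarrow> bool"
  assumes "finite A" "asymp_on A R"
    and negatively_transitive: "\<And>x y z. \<lbrakk>x \<in> A; y \<in> A; z \<in> A; R x z\<rbrakk> \<Longrightarrow> R x y \<or> R y z"
  obtains f :: "'a \<Rightarrow> nat" where "\<And>x y. \<lbrakk>x \<in> A; y \<in> A\<rbrakk> \<Longrightarrow> R x y \<longleftrightarrow> f x < f y"
proof
  let ?below = "\<lambda>y. {x \<in> A. R x y}"
  fix x y assume "x \<in> A" "y \<in> A"
  show "R x y \<longleftrightarrow> card (?below x) < card (?below y)"
  proof
    assume "R x y"
    then have "?below x \<subseteq> ?below y"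
      using \<open>x \<in> A\<close> \<open>y \<in> A\<close> negatively_transitive asymp_onD[OF assms(2)] by blast
    moreover have "x \<in> ?below y" "x \<notin> ?below x"
      using \<open>R x y\<close> \<open>x \<in> A\<close> asymp_onD[OF assms(2)] by auto
    ultimately show "card (?below x) < card (?below y)"
      using \<open>finite A\<close> by (intro psubset_card_mono) auto
  next
    assume less: "card (?below x) < card (?below y)"
    show "R x y"
    proof (rule ccontr)
      assume "\<not> R x y"
      then have "?below y \<subseteq> ?below x"
        using \<open>x \<in> A\<close> \<open>y \<in> A\<close> negatively_transitive by blast
      then have "card (?below y) \<le> card (?below x)"
        using \<open>finite A\<close> by (intro card_mono) auto
      with less show False by simp
    qed
  qed
qed

lemma k_anti_traceable_3_source_or_sink:
  assumes "k_anti_traceable 3 D" "S \<subseteq> verts D" "card S = 3"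
  obtains b where "b \<in> S"
    "(\<forall>a\<in>S - {b}. b \<rightarrow>\<^bsub>D\<^esub> a) \<or> (\<forall>a\<in>S - {b}. a \<rightarrow>\<^bsub>D\<^esub> b)"
proof -
  have "anti_traceable (D \<restriction> S)"
    using assms unfolding k_anti_traceable_def by blast
  then obtain xs d where xs: "distinct xs" "set xs = S"
    and arc: "\<And>i. Suc i < length xs \<Longrightarrow> arc_dir (D \<restriction> S) (d i) (xs ! i) (xs ! Suc i)"
    and alternating: "\<And>i. Suc (Suc i) < length xs \<Longrightarrow> d i \<noteq> d (Suc i)"
    unfolding anti_traceable_def anti_directed_path_def hamiltonian_def by auto
  have "length xs = 3"
    using xs assms(3) distinct_card by metis
  then obtain a b c where abc: "xs = [a, b, c]"
    by (auto simp: numeral_3_eq_3 length_Suc_conv)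
  have "b \<rightarrow>\<^bsub>D\<^esub> a \<and> b \<rightarrow>\<^bsub>D\<^esub> c \<or> a \<rightarrow>\<^bsub>D\<^esub> b \<and> c \<rightarrow>\<^bsub>D\<^esub> b"
    using arc[of 0] arc[of 1] alternating[of 0] abc
    by (auto simp: arc_dir_def split: if_splits dest: dominates_induce_subgraphD)
  with xs abc show thesis by (intro that[of b]) auto
qed

lemma k_anti_traceable_3_triple_has_arc:
  assumes "k_anti_traceable 3 D" "S \<subseteq> verts D" "card S = 3"
  obtains a b where "a \<in> S" "b \<in> S" "a \<rightarrow>\<^bsub>D\<^esub> b"
proof -
  obtain b where b: "b \<in> S"
    "(\<forall>a\<in>S - {b}. b \<rightarrow>\<^bsub>D\<^esub> a) \<or> (\<forall>a\<in>S - {b}. a \<rightarrow>\<^bsub>D\<^esub> b)"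
    using k_anti_traceable_3_source_or_sink[OF assms] .
  have "card (S - {b}) = 2" using b(1) assms(3) by simp
  then have "S - {b} \<noteq> {}" by (metis card.empty zero_neq_numeral)
  then obtain a where "a \<in> S - {b}" by blast
  with b that show thesis by blast
qed

definition almost_transitive_ordering :: "('a, 'b) pre_digraph \<Rightarrow> 'a list \<Rightarrow> bool" where
  "almost_transitive_ordering G vs \<longleftrightarrow>
     distinct vs \<and> set vs = verts G \<and>
     (\<forall>i j. i + 2 \<le> j \<longrightarrow> j < length vs \<longrightarrow> vs ! i \<rightarrow>\<^bsub>G\<^esub> vs ! j)"

lemma almost_transitive_orderingD:
  assumes "almost_transitive_ordering G vs"
  shows "distinct vs" "set vs = verts G" "length vs = card (verts G)"
    "\<lbrakk>i + 2 \<le> j; j < length vs\<rbrakk> \<Longrightarrow> vs ! i \<rightarrow>\<^bsub>G\<^esub> vs ! j"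
  using assms distinct_card[of vs] by (auto simp: almost_transitive_ordering_def)

context oriented_graph
begin

lemma dominates_asym: "u \<rightarrow> v \<Longrightarrow> \<not> v \<rightarrow> u"
  using asym_arcs by (meson asymD)

lemma k_anti_traceable_3_dominates_negatively_transitive:
  assumes "k_anti_traceable 3 G" "x \<rightarrow> z" "y \<in> verts G"
  shows "x \<rightarrow> y \<or> y \<rightarrow> z"
proof (cases "y = x \<or> y = z")
  case False
  have "x \<noteq> z" using assms(2) dominates_asym by blast
  with False have "card {x, y, z} = 3" by auto
  moreover have "{x, y, z} \<subseteq> verts G" using assms(2,3) by auto
  ultimately obtain b where "b \<in> {x, y, z}"
    "(\<forall>a\<in>{x, y, z} - {b}. b \<rightarrow> a) \<or> (\<forall>a\<in>{x, y, z} - {b}. a \<rightarrow> b)"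
    using k_anti_traceable_3_source_or_sink[OF assms(1)] by metis
  with False \<open>x \<noteq> z\<close> assms(2) show ?thesis
    using dominates_asym by auto
qed (use assms(2) in auto)

theorem k_anti_traceable_3_imp_almost_transitive_ordering:
  assumes "k_anti_traceable 3 G"
  obtains vs where "almost_transitive_ordering G vs"
proof -
  obtain f :: "'a \<Rightarrow> nat" where
    f: "\<And>u w. \<lbrakk>u \<in> verts G; w \<in> verts G\<rbrakk> \<Longrightarrow> u \<rightarrow> w \<longleftrightarrow> f u < f w"
  proof (rule strict_weak_order_imp_ranking[of "verts G" "dominates G"])
    show "asymp_on (verts G) (dominates G)"
      using dominates_asym by (intro asymp_onI)
  qed (use k_anti_traceable_3_dominates_negatively_transitive[OF assms] in auto)
  obtain us where us: "set us = verts G" "distinct us"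
    using finite_distinct_list[OF finite_verts] by blast
  define vs where "vs = sort_key f us"
  have vs: "set vs = verts G" "distinct vs" "sorted (map f vs)"
    using us by (auto simp: vs_def)
  have "vs ! i \<rightarrow> vs ! j" if ij: "i + 2 \<le> j" "j < length vs" for i j
  proof (rule ccontr)
    assume not_dom: "\<not> vs ! i \<rightarrow> vs ! j"
    let ?S = "{vs ! i, vs ! Suc i, vs ! j}"
    have S: "?S \<subseteq> verts G" using ij vs(1) nth_mem by fastforce
    have card_S: "card ?S = 3"
      using ij vs(2) by (auto simp: card_insert_if nth_eq_iff_index_eq)
    have "f (vs ! i) \<le> f (vs ! Suc i)" "f (vs ! Suc i) \<le> f (vs ! j)"
      using sorted_nth_mono[OF vs(3), of i "Suc i"] sorted_nth_mono[OF vs(3), of "Suc i" j] ij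
      by auto
    moreover have "f (vs ! j) \<le> f (vs ! i)" using not_dom f S by auto
    ultimately have "\<forall>u\<in>?S. \<forall>w\<in>?S. f u = f w" by auto
    moreover obtain a b where "a \<in> ?S" "b \<in> ?S" "a \<rightarrow> b"
      using k_anti_traceable_3_triple_has_arc[OF assms S card_S] .
    ultimately show False using f S by (metis less_irrefl subsetD)
  qed
  with vs show thesis
    by (intro that[of vs]) (auto simp: almost_transitive_ordering_def)
qed

end

lemma arc_dir_splice:
  assumes "length bs \<le> length as" "length as \<le> Suc (length bs)"
    and "\<And>i. i < length bs \<Longrightarrow> as ! i \<rightarrow>\<^bsub>D\<^esub> bs ! i"
    and "\<And>i. Suc i < length as \<Longrightarrow> as ! Suc i \<rightarrow>\<^bsub>D\<^esub> bs ! i"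
    and "Suc k < length as + length bs"
  shows "arc_dir D (even k) (splice as bs ! k) (splice as bs ! Suc k)"
proof (cases "even k")
  case True
  then obtain i where "k = 2 * i" by (elim evenE)
  with assms show ?thesis
    by (simp add: arc_dir_def nth_splice_even nth_splice_odd)
next
  case False
  then obtain i where "k = Suc (2 * i)" by (auto elim: oddE)
  with assms nth_splice_even[of "Suc i" as bs] show ?thesis
    by (simp add: arc_dir_def nth_splice_odd)
qed

lemma anti_directed_path_splice:
  assumes "length bs \<le> length as" "length as \<le> Suc (length bs)" "as \<noteq> []"
    and "distinct (as @ bs)" "set as \<union> set bs \<subseteq> verts D"
    and "\<And>i. i < length bs \<Longrightarrow> as ! i \<rightarrow>\<^bsub>D\<^esub> bs ! i"
    and "\<And>i. Suc i < length as \<Longrightarrow> as ! Suc i \<rightarrow>\<^bsub>D\<^esub> bs ! i"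
  shows "anti_directed_path D (splice as bs)"
  unfolding anti_directed_path_def
proof (intro conjI exI[of _ even] allI impI)
  show "arc_dir D (even k) (splice as bs ! k) (splice as bs ! Suc k)"
    if "Suc k < length (splice as bs)" for k
    using that assms by (intro arc_dir_splice) auto
qed (use assms(3-5) in \<open>auto simp: set_splice distinct_splice\<close>)

lemma anti_directed_cycle_splice:
  assumes "length as = m" "length bs = m" "2 \<le> m"
    and "distinct (as @ bs)" "set as \<union> set bs \<subseteq> verts D"
    and "\<And>i. i < m \<Longrightarrow> as ! i \<rightarrow>\<^bsub>D\<^esub> bs ! i"
    and "\<And>i. i < m \<Longrightarrow> as ! (Suc i mod m) \<rightarrow>\<^bsub>D\<^esub> bs ! i"
  shows "anti_directed_cycle D (splice as bs)"
proof -
  have arc: "arc_dir D (even k) (splice as bs ! k) (splice as bs ! (Suc k mod (2 * m)))"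
    if "k < 2 * m" for k
  proof (cases "Suc k = 2 * m")
    case True
    then have k: "k = Suc (2 * (m - 1))" using \<open>2 \<le> m\<close> by simp
    have "splice as bs ! k = bs ! (m - 1)"
      unfolding k using assms(1-3) by (intro nth_splice_odd) auto
    moreover have "splice as bs ! 0 = as ! 0"
      using nth_splice_even[of 0 as bs] assms(1-3) by simp
    moreover have "as ! 0 \<rightarrow>\<^bsub>D\<^esub> bs ! (m - 1)"
      using assms(7)[of "m - 1"] \<open>2 \<le> m\<close> by simp
    ultimately show ?thesis using True k by (simp add: arc_dir_def)
  next
    case False
    have "as ! Suc i \<rightarrow>\<^bsub>D\<^esub> bs ! i" if "Suc i < m" for i
      using assms(7)[of i] that by simp
    with False that assms(1,2,6) show ?thesis
      by (simp add: arc_dir_splice)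
  qed
  have len: "length (splice as bs) = 2 * m" using assms(1,2) by simp
  show ?thesis
    unfolding anti_directed_cycle_def len
  proof (intro conjI exI[of _ even] allI impI)
    show "even k \<noteq> even (Suc k mod (2 * m))" for k
      by (simp add: dvd_mod_iff)
  qed (use arc assms(3-5) in \<open>simp_all add: set_splice distinct_splice\<close>)
qed

lemma almost_transitive_ordering_imp_hamiltonian_path:
  assumes "almost_transitive_ordering D vs" "5 \<le> length vs"
  shows "\<exists>xs. anti_directed_path D xs \<and> hamiltonian D xs"
proof -
  note vs = almost_transitive_orderingD[OF assms(1)]
  define c where "c = (length vs + 1) div 2"
  let ?as = "take c vs" and ?bs = "drop c vs"
  have c: "3 \<le> c" "c \<le> length vs" "length vs \<le> 2 * c" "2 * c \<le> Suc (length vs)"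
    using assms(2) by (auto simp: c_def)
  have verts: "set ?as \<union> set ?bs = verts D"
    using vs(2) by (simp flip: set_append)
  moreover have "anti_directed_path D (splice ?as ?bs)"
    using c vs(1) verts by (intro anti_directed_path_splice) (auto intro!: vs(4))
  ultimately show ?thesis
    unfolding hamiltonian_def by (metis set_splice)
qed

lemma almost_transitive_ordering_imp_even_cycle:
  assumes "almost_transitive_ordering D vs" "5 \<le> length vs" "2 \<le> m" "2 * m \<le> length vs"
  shows "\<exists>xs. anti_directed_cycle D xs \<and> length xs = 2 * m"
proof -
  note vs = almost_transitive_orderingD[OF assms(1)]
  define c where "c = length vs - m"
  let ?as = "take m vs" and ?bs = "drop c vs"
  have c: "3 \<le> c" "m \<le> c" "length vs = c + m"
    using assms(2-4) by (auto simp: c_def)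
  have "vs ! (Suc i mod m) \<rightarrow>\<^bsub>D\<^esub> vs ! (c + i)" if "i < m" for i
  proof (cases "Suc i = m")
    case True
    then show ?thesis using c by (intro vs(4)) auto
  next
    case False
    then show ?thesis using c that by (intro vs(4)) auto
  qed
  moreover have "vs ! i \<rightarrow>\<^bsub>D\<^esub> vs ! (c + i)" if "i < m" for i
    using c that by (intro vs(4)) auto
  moreover have "distinct (?as @ ?bs)"
    using vs(1) c by (simp add: set_take_disj_set_drop_if_distinct)
  moreover have "set ?as \<union> set ?bs \<subseteq> verts D"
    using vs(2) set_take_subset set_drop_subset by fastforce
  ultimately have "anti_directed_cycle D (splice ?as ?bs)"
    using c \<open>2 \<le> m\<close> by (intro anti_directed_cycle_splice[of _ m]) auto
  moreover have "length (splice ?as ?bs) = 2 * m"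
    using c by simp
  ultimately show ?thesis by blast
qed

lemma (in fin_digraph) anti_directed_cycle_hamiltonian:
  assumes "anti_directed_cycle G xs" "length xs = card (verts G)"
  shows "hamiltonian G xs"
  using assms distinct_card[of xs] card_subset_eq[OF finite_verts, of "set xs"]
  by (simp add: anti_directed_cycle_def hamiltonian_def)

theorem theorem3:
  fixes D :: "('a, 'b) pre_digraph"
  assumes "oriented_graph D"
    and "k_anti_traceable 3 D"
    and "card (verts D) \<ge> 5"
  shows "(even (card (verts D)) \<longrightarrow>
            (\<exists>xs. anti_directed_cycle D xs \<and> hamiltonian D xs)) \<and>
         (odd (card (verts D)) \<longrightarrow>
            (\<exists>xs. anti_directed_cycle D xs \<and> length xs = card (verts D) - 1) \<and>
            (\<exists>xs. anti_directed_path D xs \<and> hamiltonian D xs))"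
proof -
  interpret oriented_graph D by fact
  let ?n = "card (verts D)"
  obtain vs where vs: "almost_transitive_ordering D vs"
    using k_anti_traceable_3_imp_almost_transitive_ordering[OF assms(2)] .
  then have len: "length vs = ?n" by (rule almost_transitive_orderingD)
  have "2 \<le> ?n div 2" "2 * (?n div 2) \<le> ?n" using assms(3) by linarith+
  then obtain xs where cycle: "anti_directed_cycle D xs" and "length xs = 2 * (?n div 2)"
    using almost_transitive_ordering_imp_even_cycle[OF vs] len assms(3) by metis
  then have "even ?n \<Longrightarrow> hamiltonian D xs" "odd ?n \<Longrightarrow> length xs = ?n - 1"
    by (auto intro: anti_directed_cycle_hamiltonian elim: oddE)
  moreover have "\<exists>ys. anti_directed_path D ys \<and> hamiltonian D ys"
    using almost_transitive_ordering_imp_hamiltonian_path[OF vs] len assms(3) by simp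
  ultimately show ?thesis using cycle by blast
qed

end
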